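(* Let $V$ and $W$ be binomial varieties of $\mathbb{P}^n$ that have the same binomial exponents. Let $V' \subseteq V$ be any subvariety. If there exists a point $p = [p_0:\cdots:p_n] \in V'$ with $p_0\cdots p_n \neq 0$, then $$p \star W = V' \star W = V \star W.$$
   Context: $k$ is an algebraically closed field of characteristic zero, $\mathbb{P}^n$ is projective $n$-space over $k$, and $R = k[x_0,\ldots,x_n]$ has the standard grading. Projective varieties (and subvarieties) are Zariski closed subsets of $\mathbb{P}^n$ and need not be irreducible; $\mathbb{I}(X) \subseteq R$ denotes the homogeneous vanishing ideal of $X$. For $\alpha = (\alpha_0,\ldots,\alpha_n) \in \mathbb{N}^{n+1}$, $X^\alpha := x_0^{\alpha_0}\cdots x_n^{\alpha_n}$. Hadamard product: for points $p=[p_0:\cdots:p_n]$, $q=[q_0:\cdots:q_n]$, $p\star q := [p_0q_0:\cdots:p_nq_n]$, which is defined when $p_iq_i \neq 0$ for at least one $i$. For projective varieties $X,Y \subseteq \mathbb{P}^n$, $X \star Y$ is the Zariski closure of $\{p\star q \mid p \in X, q\in Y, p\star q \text{ is defined}\}$ in $\mathbb{P}^n$. For a point $p$, $p \star Y := \{p\}\star Y$. A binomial is a polynomial with exactly two terms, $a_1X^{\alpha_1}-a_2X^{\alpha_2}$ with $a_1,a_2 \in k\setminus\{0\}$ and $\alpha_1\neq\alpha_2$; it is homogeneous if both monomials have the same degree. A projective variety $V \subseteq \mathbb{P}^n$ is a binomial variety if $\mathbb{I}(V)$ is generated by homogeneous binomials. Two binomial varieties $V$ and $W$ have the same binomial exponents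 if there are ordered lists $\alpha_1,\ldots,\alpha_s$ and $\beta_1,\ldots,\beta_s$ in $\mathbb{N}^{n+1}$, with $\alpha_i \neq \beta_i$ for all $i$ and the pairs $(\alpha_i,\beta_i)$ pairwise distinct, and nonzero constants $a_i,b_i,c_i,d_i \in k$ ($i=1,\ldots,s$) such that $\mathbb{I}(V) = \langle a_1X^{\alpha_1}-b_1X^{\beta_1},\ldots,a_sX^{\alpha_s}-b_sX^{\beta_s}\rangle$ and $\mathbb{I}(W) = \langle c_1X^{\alpha_1}-d_1X^{\beta_1},\ldots,c_sX^{\alpha_s}-d_sX^{\beta_s}\rangle$. *)

theory Defs
  imports "HOL-Analysis.Analysis" "HOL-Library.Poly_Mapping"
begin

text \<open>
  Coordinates are indexed by a finite type \<open>'n\<close>, so that projective \<open>n\<close>-space is obtained for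
  \<open>CARD('n) = n + 1\<close>. The product \<open>v * w\<close> of two vectors of type \<open>'k ^ 'n\<close> is the componentwise one.
\<close>

subsection \<open>Projective space\<close>

definition proj_eq :: "'k::field ^ 'n::finite \<Rightarrow> 'k ^ 'n \<Rightarrow> bool" where
  "proj_eq v w \<longleftrightarrow> v \<noteq> 0 \<and> (\<exists>c. c \<noteq> 0 \<and> w = c *s v)"

lemma part_equivp_proj_eq: "part_equivp (proj_eq :: 'k::field ^ 'n::finite \<Rightarrow> 'k ^ 'n \<Rightarrow> bool)"
proof (rule part_equivpI)
  have "proj_eq (1 :: 'k ^ 'n) 1"
    unfolding proj_eq_def by (auto intro!: exI[of _ 1])
  then show "\<exists>v :: 'k ^ 'n. proj_eq v v" ..
  show "symp (proj_eq :: 'k ^ 'n \<Rightarrow> 'k ^ 'n \<Rightarrow> bool)"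
  proof (rule sympI)
    fix v w :: "'k ^ 'n"
    assume "proj_eq v w"
    then obtain c where c: "v \<noteq> 0" "c \<noteq> 0" "w = c *s v" by (auto simp: proj_eq_def)
    then have "v = inverse c *s w" by (simp add: vector_smult_assoc)
    with c show "proj_eq w v" unfolding proj_eq_def
      by (metis inverse_zero_imp_zero vector_smult_lzero vector_smult_rzero)
  qed
  show "transp (proj_eq :: 'k ^ 'n \<Rightarrow> 'k ^ 'n \<Rightarrow> bool)"
  proof (rule transpI)
    fix u v w :: "'k ^ 'n"
    assume "proj_eq u v" "proj_eq v w"
    then obtain c d where "u \<noteq> 0" "c \<noteq> 0" "d \<noteq> 0" "w = (d * c) *s u"
      by (auto simp: proj_eq_def vector_smult_assoc)
    then show "proj_eq u w" unfolding proj_eq_def by (intro conjI exI[of _ "d * c"]) simp_all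
  qed
qed

text \<open>
  \<open>point v\<close> is the point with homogeneous coordinates \<open>v\<close>; it is meaningful only for \<open>v \<noteq> 0\<close>.
  \<open>hcoords p\<close> is some choice of homogeneous coordinates of \<open>p\<close>.
\<close>

quotient_type (overloaded) ('k, 'n) pspace = "'k::field ^ 'n::finite" / partial: proj_eq
  morphisms hcoords point
  by (rule part_equivp_proj_eq)

lemma hcoords_nonzero: "hcoords p \<noteq> 0"
  using Quotient_rep_reflp[OF Quotient_pspace, of p] by (simp add: proj_eq_def)

lemma point_hcoords [simp]: "point (hcoords p) = p"
  by (rule Quotient_abs_rep[OF Quotient_pspace])

lemma point_eq_iff:
  assumes "v \<noteq> 0" "w \<noteq> 0"
  shows "point v = point w \<longleftrightarrow> (\<exists>c. c \<noteq> 0 \<and> w = c *s v)"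
proof -
  have refl: "proj_eq u u" if "u \<noteq> 0" for u :: "'a ^ 'b"
    using that unfolding proj_eq_def by (auto intro!: exI[of _ 1])
  show ?thesis
    using Quotient_rel[OF Quotient_pspace, of v w] refl assms by (auto simp: proj_eq_def)
qed

lemma hcoords_point:
  assumes "v \<noteq> 0"
  obtains c where "c \<noteq> 0" "hcoords (point v) = c *s v"
  using point_eq_iff[OF assms hcoords_nonzero, of "point v"] by auto

subsection \<open>Polynomials and ideals\<close>

type_synonym ('k, 'n) mpoly = "('n \<Rightarrow>\<^sub>0 nat) \<Rightarrow>\<^sub>0 'k"

definition mon_degree :: "('n::finite \<Rightarrow>\<^sub>0 nat) \<Rightarrow> nat" where
  "mon_degree \<alpha> = (\<Sum>i\<in>UNIV. Poly_Mapping.lookup \<alpha> i)"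

definition peval :: "('k::field, 'n::finite) mpoly \<Rightarrow> 'k ^ 'n \<Rightarrow> 'k" where
  "peval f v = (\<Sum>\<alpha>\<in>Poly_Mapping.keys f.
     Poly_Mapping.lookup f \<alpha> * (\<Prod>i\<in>UNIV. v $ i ^ Poly_Mapping.lookup \<alpha> i))"

definition homogeneous :: "('k::field, 'n::finite) mpoly \<Rightarrow> bool" where
  "homogeneous f \<longleftrightarrow> (\<exists>d. \<forall>\<alpha>\<in>Poly_Mapping.keys f. mon_degree \<alpha> = d)"

definition binom_poly :: "'k::field \<Rightarrow> ('n \<Rightarrow>\<^sub>0 nat) \<Rightarrow> 'k \<Rightarrow> ('n \<Rightarrow>\<^sub>0 nat) \<Rightarrow> ('k, 'n::finite) mpoly" where
  "binom_poly a \<alpha> b \<beta> = Poly_Mapping.single \<alpha> a - Poly_Mapping.single \<beta> b"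

definition is_binomial :: "('k::field, 'n::finite) mpoly \<Rightarrow> bool" where
  "is_binomial f \<longleftrightarrow> (\<exists>a \<alpha> b \<beta>. a \<noteq> 0 \<and> b \<noteq> 0 \<and> \<alpha> \<noteq> \<beta> \<and> f = binom_poly a \<alpha> b \<beta>)"

lemma module_times: "module ((*) :: 'a::comm_ring_1 \<Rightarrow> 'a \<Rightarrow> 'a)"
  by standard (simp_all add: algebra_simps)

text \<open>The ideal generated by a set: the span in the ring regarded as a module over itself.\<close>

abbreviation ideal_gen :: "'a::comm_ring_1 set \<Rightarrow> 'a set" where
  "ideal_gen \<equiv> module.span (*)"

subsection \<open>Projective varieties\<close>

text \<open>
  Only ever applied to homogeneous \<open>f\<close>, where one representative of \<open>p\<close> is as good as all of them.
\<close>

definition vanishes_at :: "('k::field, 'n::finite) mpoly \<Rightarrow> ('k, 'n) pspace \<Rightarrow> bool" where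
  "vanishes_at f p \<longleftrightarrow> (\<forall>v. v \<noteq> 0 \<and> point v = p \<longrightarrow> peval f v = 0)"

definition proj_variety :: "('k::field, 'n::finite) pspace set \<Rightarrow> bool" where
  "proj_variety X \<longleftrightarrow>
     (\<exists>S. (\<forall>f\<in>S. homogeneous f) \<and> X = {p. \<forall>f\<in>S. vanishes_at f p})"

definition zariski_closure :: "('k::field, 'n::finite) pspace set \<Rightarrow> ('k, 'n) pspace set" where
  "zariski_closure X = proj_variety hull X"

definition vanishing_ideal :: "('k::field, 'n::finite) pspace set \<Rightarrow> ('k, 'n) mpoly set" where
  "vanishing_ideal X = ideal_gen {f. homogeneous f \<and> (\<forall>p\<in>X. vanishes_at f p)}"

definition binomial_variety :: "('k::field, 'n::finite) pspace set \<Rightarrow> bool" where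
  "binomial_variety V \<longleftrightarrow> proj_variety V \<and>
     (\<exists>B. (\<forall>f\<in>B. is_binomial f \<and> homogeneous f) \<and> vanishing_ideal V = ideal_gen B)"

definition same_binomial_exponents ::
  "('k::field, 'n::finite) pspace set \<Rightarrow> ('k, 'n) pspace set \<Rightarrow> bool" where
  "same_binomial_exponents V W \<longleftrightarrow>
     (\<exists>(s::nat) \<alpha> \<beta> a b c d.
        (\<forall>i<s. \<alpha> i \<noteq> \<beta> i) \<and> inj_on (\<lambda>i. (\<alpha> i, \<beta> i)) {..<s} \<and>
        (\<forall>i<s. a i \<noteq> 0 \<and> b i \<noteq> 0 \<and> c i \<noteq> 0 \<and> d i \<noteq> 0) \<and>
        vanishing_ideal V = ideal_gen {binom_poly (a i) (\<alpha> i) (b i) (\<beta> i) | i. i < s} \<and>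
        vanishing_ideal W = ideal_gen {binom_poly (c i) (\<alpha> i) (d i) (\<beta> i) | i. i < s})"

subsection \<open>Hadamard products\<close>

definition hadamard_defined :: "('k::field, 'n::finite) pspace \<Rightarrow> ('k, 'n) pspace \<Rightarrow> bool" where
  "hadamard_defined p q \<longleftrightarrow> (\<exists>i. hcoords p $ i * hcoords q $ i \<noteq> 0)"

definition hadamard_point ::
  "('k::field, 'n::finite) pspace \<Rightarrow> ('k, 'n) pspace \<Rightarrow> ('k, 'n) pspace" where
  "hadamard_point p q = point (hcoords p * hcoords q)"

text \<open>Neither notion depends on the chosen coordinates.\<close>

lemma hadamard_defined_point:
  assumes "v \<noteq> 0" "w \<noteq> 0"
  shows "hadamard_defined (point v) (point w) \<longleftrightarrow> (\<exists>i. v $ i * w $ i \<noteq> 0)"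
proof -
  obtain c d where "c \<noteq> 0" "hcoords (point v) = c *s v" "d \<noteq> 0" "hcoords (point w) = d *s w"
    using hcoords_point assms by metis
  then show ?thesis by (simp add: hadamard_defined_def)
qed

lemma hadamard_point_point:
  assumes "v * w \<noteq> 0"
  shows "hadamard_point (point v) (point w) = point (v * w)"
proof -
  have nz: "v \<noteq> 0" "w \<noteq> 0" using assms by auto
  obtain c d where cd: "c \<noteq> 0" "hcoords (point v) = c *s v" "d \<noteq> 0" "hcoords (point w) = d *s w"
    using hcoords_point nz by metis
  have eq: "hcoords (point v) * hcoords (point w) = (c * d) *s (v * w)"
    using cd by (simp add: vec_eq_iff)
  have "(c * d) *s (v * w) \<noteq> 0" using cd assms by (simp add: vec_eq_iff)
  then have "point (v * w) = point ((c * d) *s (v * w))"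
    using point_eq_iff[OF assms] cd by (metis mult_eq_0_iff)
  then show ?thesis by (simp add: hadamard_point_def eq)
qed

definition hadamard ::
  "('k::field, 'n::finite) pspace set \<Rightarrow> ('k, 'n) pspace set \<Rightarrow> ('k, 'n) pspace set"
  (infixl \<open>\<star>\<close> 70) where
  "X \<star> Y = zariski_closure {hadamard_point p q | p q. p \<in> X \<and> q \<in> Y \<and> hadamard_defined p q}"

end

theory Submission
  imports Defs
begin

text \<open>
  Let \<open>q \<in> V\<close> and \<open>r \<in> W\<close> with \<open>q \<star> r\<close> defined. Since no coordinate of \<open>p\<close> vanishes,
  \<open>q \<star> r = p \<star> u\<close> for \<open>u = p\<inverse> \<star> q \<star> r\<close>. The binomial equations of \<open>V\<close> at \<open>p\<close> and at \<open>q\<close> give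
  \<open>p\<^sup>\<alpha> q\<^sup>\<beta> = p\<^sup>\<beta> q\<^sup>\<alpha>\<close> for each pair of exponents, so multiplication by \<open>p\<inverse> \<star> q\<close> preserves
  the binomial equations of \<open>W\<close>, that is, \<open>u \<in> W\<close>. Hence all three products are closures of the
  same set of points.
\<close>

text \<open>The inner product of \<open>peval\<close>, named because the argument uses its
  multiplicativity both in the exponent and in the point.\<close>

definition monom_eval :: "('n::finite \<Rightarrow>\<^sub>0 nat) \<Rightarrow> 'k::field ^ 'n \<Rightarrow> 'k" where
  "monom_eval \<alpha> v = (\<Prod>i\<in>UNIV. v $ i ^ Poly_Mapping.lookup \<alpha> i)"

lemma monom_eval_add: "monom_eval (\<alpha> + \<beta>) v = monom_eval \<alpha> v * monom_eval \<beta> v"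
  by (simp add: monom_eval_def lookup_add power_add prod.distrib)

lemma monom_eval_mult: "monom_eval \<alpha> (v * w) = monom_eval \<alpha> v * monom_eval \<alpha> w"
  by (simp add: monom_eval_def power_mult_distrib prod.distrib)

lemma monom_eval_nonzero:
  assumes "(\<Prod>i\<in>UNIV. v $ i) \<noteq> 0"
  shows "monom_eval \<alpha> v \<noteq> 0"
  using assms by (simp add: monom_eval_def)

text \<open>Updating at a fresh key amounts to adding a single term. The additive form lets
  identities that are linear in a polynomial be reduced to monomials.\<close>

lemma poly_mapping_add_single_induct [case_names zero add_single]:
  fixes f :: "'a \<Rightarrow>\<^sub>0 'b::monoid_add"
  assumes "P 0" and "\<And>f k a. P f \<Longrightarrow> P (f + Poly_Mapping.single k a)"
  shows "P f"
proof (induction f rule: update_induct)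
  case const
  show ?case by (rule assms(1))
next
  case (update f k a)
  have "Poly_Mapping.update k a f = f + Poly_Mapping.single k a"
    using update.hyps
    by (intro poly_mapping_eqI) (auto simp: lookup_update lookup_add lookup_single in_keys_iff)
  then show ?case using assms(2) update.IH by simp
qed

text \<open>Keys can disappear by cancellation in a sum, or when a coefficient is zero. A common
  larger index set makes the evaluations comparable term by term.\<close>

lemma peval_superset:
  assumes "finite A" "Poly_Mapping.keys f \<subseteq> A"
  shows "peval f v = (\<Sum>\<alpha>\<in>A. Poly_Mapping.lookup f \<alpha> * monom_eval \<alpha> v)"
  unfolding peval_def monom_eval_def
  using assms by (intro sum.mono_neutral_left) (auto simp: in_keys_iff)

lemma peval_zero [simp]: "peval 0 v = 0"
  by (simp add: peval_def)

lemma peval_single [simp]: "peval (Poly_Mapping.single \<alpha> a) v = a * monom_eval \<alpha> v"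
  by (subst peval_superset[of "{\<alpha>}"]) (auto simp: lookup_single)

lemma peval_add [simp]: "peval (f + g) v = peval f v + peval g v"
proof -
  let ?A = "Poly_Mapping.keys f \<union> Poly_Mapping.keys g"
  have "Poly_Mapping.keys (f + g) \<subseteq> ?A" by (rule Poly_Mapping.keys_add)
  then show ?thesis
    by (simp add: peval_superset[of ?A] lookup_add distrib_right sum.distrib)
qed

lemma peval_diff [simp]: "peval (f - g) v = peval f v - peval g v"
  using peval_add[of "f - g" g v] by simp

text \<open>Both sides are additive in each factor, so one induction per factor reduces the claim to
  two monomials, where it is \<open>monom_eval_add\<close>.\<close>

lemma peval_mult [simp]: "peval (f * g) v = peval f v * peval g v"
proof -
  have single: "peval (Poly_Mapping.single \<alpha> a * g) v = a * monom_eval \<alpha> v * peval g v" for \<alpha> a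
    by (induction g rule: poly_mapping_add_single_induct)
      (simp_all add: mult_single monom_eval_add distrib_left)
  show ?thesis
    by (induction f rule: poly_mapping_add_single_induct)
      (simp_all add: single distrib_right)
qed

lemma peval_binom_poly [simp]:
  "peval (binom_poly a \<alpha> b \<beta>) v = a * monom_eval \<alpha> v - b * monom_eval \<beta> v"
  by (simp add: binom_poly_def)

text \<open>The polynomials vanishing at a fixed vector form an ideal.\<close>

lemma peval_ideal_gen:
  assumes "f \<in> ideal_gen S" "\<And>g. g \<in> S \<Longrightarrow> peval g v = 0"
  shows "peval f v = 0"
  using module.span_induct_alt[OF module_times assms(1), of "\<lambda>h. peval h v = 0"] assms(2)
  by simp

text \<open>The ideal also has inhomogeneous members, but its generators vanish at every coordinate
  vector of a point of \<open>X\<close>, and hence so do all members.\<close>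

lemma peval_vanishing_ideal:
  assumes "f \<in> vanishing_ideal X" "v \<noteq> 0" "point v \<in> X"
  shows "peval f v = 0"
  using assms(1) unfolding vanishing_ideal_def
  by (rule peval_ideal_gen) (use assms(2,3) in \<open>auto simp: vanishes_at_def\<close>)

text \<open>The homogeneous equations defining \<open>X\<close> belong to its vanishing ideal, so
  \<open>X\<close> is cut out by that ideal.\<close>

lemma proj_variety_memI:
  assumes "proj_variety X"
    and "\<And>f v. f \<in> vanishing_ideal X \<Longrightarrow> v \<noteq> 0 \<Longrightarrow> point v = x \<Longrightarrow> peval f v = 0"
  shows "x \<in> X"
proof -
  obtain S where S: "\<forall>f\<in>S. homogeneous f" "X = {p. \<forall>f\<in>S. vanishes_at f p}"
    using assms(1) unfolding proj_variety_def by blast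
  have "f \<in> vanishing_ideal X" if "f \<in> S" for f
    unfolding vanishing_ideal_def using S that by (intro module.span_base[OF module_times]) auto
  then show ?thesis using S(2) assms(2) by (auto simp: vanishes_at_def)
qed

lemma zariski_closure_mono: "X \<subseteq> Y \<Longrightarrow> zariski_closure X \<subseteq> zariski_closure Y"
  unfolding zariski_closure_def by (rule hull_mono)

lemma hadamard_mono_left: "X \<subseteq> X' \<Longrightarrow> X \<star> Y \<subseteq> X' \<star> Y"
  unfolding hadamard_def by (rule zariski_closure_mono) blast

text \<open>The equation \<open>v * u = q * r\<close> encodes the quotient of \<open>q * r\<close>
  by \<open>v\<close> without division, so it can be fed directly into the multiplicative
  \<open>monom_eval\<close>.\<close>

lemma binomial_translate_mem:
  fixes V W :: "('k::field, 'n::finite) pspace set" and u v q r :: "'k ^ 'n"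
  assumes "same_binomial_exponents V W" "proj_variety W"
    and "(\<Prod>i\<in>UNIV. v $ i) \<noteq> 0" "v \<noteq> 0" "point v \<in> V"
    and "q \<noteq> 0" "point q \<in> V" and "r \<noteq> 0" "point r \<in> W"
    and "u \<noteq> 0" "v * u = q * r"
  shows "point u \<in> W"
proof (rule proj_variety_memI[OF assms(2)])
  fix f and w :: "'k ^ 'n"
  assume f: "f \<in> vanishing_ideal W" and w: "w \<noteq> 0" "point w = point u"
  obtain t where t: "t \<noteq> 0" "w = t *s u"
    using point_eq_iff[OF \<open>u \<noteq> 0\<close> w(1)] w(2) by auto
  \<comment> \<open>An arbitrary coordinate vector \<open>w\<close> of \<open>point u\<close>
    differs from \<open>u\<close> by \<open>t\<close>. Moving \<open>t\<close> into \<open>r\<close>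
    keeps the same point of \<open>W\<close> and turns the relation for \<open>u\<close> into one
    for \<open>w\<close>.\<close>
  have r': "t *s r \<noteq> 0" "point (t *s r) = point r"
    using t(1) \<open>r \<noteq> 0\<close> point_eq_iff[of r "t *s r"] by auto
  have vw: "v * w = q * (t *s r)"
  proof -
    have "v * w = t *s (v * u)" by (simp add: t vec_eq_iff)
    also have "\<dots> = q * (t *s r)" by (simp add: assms(11) vec_eq_iff)
    finally show ?thesis .
  qed
  obtain s :: nat and \<alpha> \<beta> a b c d where
    nz: "\<forall>i<s. a i \<noteq> 0 \<and> b i \<noteq> 0 \<and> c i \<noteq> 0 \<and> d i \<noteq> 0"
    and IV: "vanishing_ideal V = ideal_gen {binom_poly (a i) (\<alpha> i) (b i) (\<beta> i) | i. i < s}"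
    and IW: "vanishing_ideal W = ideal_gen {binom_poly (c i) (\<alpha> i) (d i) (\<beta> i) | i. i < s}"
    using assms(1) unfolding same_binomial_exponents_def by blast
  have "c i * monom_eval (\<alpha> i) w = d i * monom_eval (\<beta> i) w" if "i < s" for i
  proof -
    have V0: "binom_poly (a i) (\<alpha> i) (b i) (\<beta> i) \<in> vanishing_ideal V"
      unfolding IV using that by (intro module.span_base[OF module_times]) auto
    have W0: "binom_poly (c i) (\<alpha> i) (d i) (\<beta> i) \<in> vanishing_ideal W"
      unfolding IW using that by (intro module.span_base[OF module_times]) auto
    define A B :: "'k ^ 'n \<Rightarrow> 'k" where "A = monom_eval (\<alpha> i)" and "B = monom_eval (\<beta> i)"
    have Av: "A v \<noteq> 0" and Bv: "B v \<noteq> 0"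
      unfolding A_def B_def using assms(3) by (rule monom_eval_nonzero)+
    have ev: "a i * A v = b i * B v"
      using peval_vanishing_ideal[OF V0 assms(4,5)] by (simp add: A_def B_def)
    have eq: "a i * A q = b i * B q"
      using peval_vanishing_ideal[OF V0 assms(6,7)] by (simp add: A_def B_def)
    have er: "c i * A (t *s r) = d i * B (t *s r)"
      using peval_vanishing_ideal[OF W0 r'(1)] r'(2) assms(9) by (simp add: A_def B_def)
    have Aw: "A v * A w = A q * A (t *s r)" and Bw: "B v * B w = B q * B (t *s r)"
      using vw by (simp_all add: A_def B_def flip: monom_eval_mult)
    \<comment> \<open>The desired equation is proved after multiplication by
      \<open>a i * A v\<close>, which is nonzero and cancels at the end. The equations at
      \<open>q\<close> and \<open>t *s r\<close> exchange \<open>A\<close> for \<open>B\<close>, and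
      the one at \<open>v\<close> restores the common factor.\<close>
    have "(a i * A v) * (c i * A w) = (a i * A q) * (c i * A (t *s r))"
      using Aw by (simp add: mult.left_commute mult.assoc)
    also have "\<dots> = (b i * B q) * (d i * B (t *s r))"
      by (simp only: eq er)
    also have "\<dots> = (b i * B v) * (d i * B w)"
      using Bw by (simp add: mult.left_commute mult.assoc)
    also have "\<dots> = (a i * A v) * (d i * B w)"
      by (simp only: ev)
    finally show ?thesis
      using nz that Av by (simp add: A_def B_def)
  qed
  then show "peval f w = 0"
    using f unfolding IW by (auto intro: peval_ideal_gen)
qed

theorem theorem1p1:
  fixes V W V' :: "('k::{alg_closed_field, field_char_0}, 'n::finite) pspace set"
    and p :: "('k, 'n) pspace" and v :: "'k ^ 'n"
  assumes "binomial_variety V" and "binomial_variety W"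
    and "same_binomial_exponents V W"
    and "proj_variety V'" and "V' \<subseteq> V"
    and "v \<noteq> 0" and "p = point v" and "p \<in> V'"
    and "(\<Prod>i\<in>UNIV. v $ i) \<noteq> 0"
  shows "{p} \<star> W = V' \<star> W \<and> V' \<star> W = V \<star> W"
proof -
  have W: "proj_variety W" using assms(2) by (simp add: binomial_variety_def)
  have "\<exists>r'\<in>W. hadamard_defined p r' \<and> hadamard_point q r = hadamard_point p r'"
    if "q \<in> V" "r \<in> W" "hadamard_defined q r" for q r
  proof -
    define x y where "x = hcoords q" and "y = hcoords r"
    have x: "x \<noteq> 0" "point x = q" and y: "y \<noteq> 0" "point y = r"
      by (simp_all add: x_def y_def hcoords_nonzero)
    have xy: "x * y \<noteq> 0"
      using that(3) by (auto simp: hadamard_defined_def x_def y_def vec_eq_iff)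
    define u where "u = (\<chi> i. inverse (v $ i)) * (x * y)"
    have vu: "v * u = x * y"
      using assms(9) by (simp add: u_def vec_eq_iff flip: mult.assoc)
    then have u: "u \<noteq> 0" using xy by auto
    have "point u \<in> W"
      using binomial_translate_mem[OF assms(3) W assms(9,6) _ x(1) _ y(1) _ u vu]
        assms(5,7,8) that x y by auto
    moreover have "hadamard_defined p (point u)"
    proof -
      have "v * u \<noteq> 0" using vu xy by simp
      then show ?thesis
        unfolding assms(7) hadamard_defined_point[OF assms(6) u] by (simp add: vec_eq_iff)
    qed
    moreover have "hadamard_point q r = hadamard_point p (point u)"
      using hadamard_point_point[OF xy] hadamard_point_point[of v u] vu xy x y assms(7) by simp
    ultimately show ?thesis by blast
  qed
  \<comment> \<open>The inclusion already holds between the sets of products before taking closures.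
    Together with monotonicity along \<open>{p} \<subseteq> V' \<subseteq> V\<close> it closes a
    cycle of inclusions.\<close>
  then have "V \<star> W \<subseteq> {p} \<star> W"
    unfolding hadamard_def by (intro zariski_closure_mono) blast
  moreover have "{p} \<star> W \<subseteq> V' \<star> W" "V' \<star> W \<subseteq> V \<star> W"
    using assms(5,8) by (auto intro!: hadamard_mono_left del: subsetI)
  ultimately show ?thesis by blast
qed

end
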